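(* Let $\hat T$ denote the grid function computed by the modified fast marching method with $n_B+1$ buckets $B_0,\dots,B_{n_B}$ and increment $\delta=\frac{h}{F_{\min}\cdot n_B}$ (described in the context), and let $T$ denote the exact solution of the discrete eikonal equation $$\max(D_{ij}^{-x}T,-D_{ij}^{+x}T,0)^2+\max(D_{ij}^{-y}T,-D_{ij}^{+y}T,0)^2=\frac{1}{F_{ij}^2},\quad (i,j)\in\Omega_D,\qquad T_{ij}=0,\quad (i,j)\in\Gamma_D .$$ Then, for all $(i,j)\in\Omega_D$, $$0\leqslant \frac{\hat T_{ij}-T_{ij}}{|\hat T_{ij}|}\leqslant \sqrt2\cdot\frac{F_{\max}}{h}\cdot\delta=\sqrt2\cdot\frac{F_{\max}}{F_{\min}}\cdot\frac1{n_B}.$$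
   Context: Setting. $F:[0,1]^2\to\mathbb R$ is a continuous function (speed function) and $F_{\min},F_{\max}$ are real numbers with $0<F_{\min}\leqslant F(x)\leqslant F_{\max}$ for all $x$. Let $n\geqslant1$ be an integer, $h=1/n$, and consider the grid points $(ih,jh)$, $i,j=0,\dots,n$. The index set $\{0,\dots,n\}^2$ is partitioned into two disjoint sets $\Omega_D$ and $\Gamma_D$, with $\Gamma_D\neq\emptyset$ ($\Gamma_D$ is the discrete boundary set). Write $F_{ij}=F(ih,jh)$. For a real-valued grid function $T=(T_{ij})_{0\le i,j\le n}$ set $$D_{ij}^{-x}T=\frac{T_{ij}-T_{i-1,j}}h,\quad -D_{ij}^{+x}T=\frac{T_{ij}-T_{i+1,j}}h,\quad D_{ij}^{-y}T=\frac{T_{ij}-T_{i,j-1}}h,\quad -D_{ij}^{+y}T=\frac{T_{ij}-T_{i,j+1}}h,$$ with the convention $T_{i,n+1}=T_{i,-1}=T_{n+1,j}=T_{-1,j}=\infty$ (so differences involving such values are $-\infty$ and do not contribute to the maxima). The neighbors of $(i,j)$ are the grid indices among $(i\pm1,j),(i,j\pm1)$. Trial values. Points can be tagged "known" or "trial". The trial value of a point $(k,l)\in\Omega_D$, computed from the known values only, is the solution $X$ of $$\max(X-a_{k-1,l},X-a_{k+1,l},0)^2+\max(X-a_{k,l-1},X-a_{k,l+1},0)^2=\frac{h^2}{F_{kl}^2},$$ where $a_{pq}$ is the current value at $(p,q)$ if $(p,q)$ is known and $a_{pq}=\infty$ otherwise. Fast marching method. Initially all points of $\Gamma_D$ are known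 with value $0$; all points of $\Omega_D$ having a neighbor in $\Gamma_D$ are tagged trial and get their trial values. $\mathcal N$ denotes the set of trial points (narrow band). Then iterate: (A1) let $(i,j)\in\mathcal N$ be the point with the smallest trial value; (A2) tag $(i,j)$ as known (its value is then final) and remove it from $\mathcal N$; (A3) tag all neighbors of $(i,j)$ which are not known as trial (unless already done) and add them to $\mathcal N$; (A4) recompute the trial values of all trial neighbors of $(i,j)$ from the known values only; (A5) if $\mathcal N\ne\emptyset$, go to (A1). Modified fast marching method (untidy priority queue). This is the same method, except that the point in (A1) is chosen using an array of $n_B+1$ buckets $B_0,\dots,B_{n_B}$ ($n_B\geqslant1$), each a list with first-in-first-out ordering, and $\delta=\frac{h}{F_{\min}n_B}$. A trial point $(i,j)$ with trial value $T_{ij}$ belongs to the bucket $B_r$ with $r=\lfloor T_{ij}/\delta\rfloor \bmod (n_B+1)$. Insertion of $(i,j)$: compute $r$ and append $(i,j)$ at the end of $B_r$. If a recomputation in (A4) changes the bucket number of a trial point, the point is inserted once more in its new bucket (the old entry is not removed). Choice of the point in (A1): an index $s$ holds the number of the bucket with the smallest trial values; if $B_s$ is empty, $s$ is repeatedly replaced by $(s+1)\bmod(n_B+1)$ until a non-empty bucket is found (if all buckets are empty the method terminates); the first element of $B_s$ is returned and removed from $B_s$; if that element is already known, it is skipped and the next one is picked. Thus no distinction is made between points in the same bucket. $\hat T_{ij}$ is the final (known) value assigned to $(i,j)$, and $\hat T_{ij}=0$ on $\Gamma_D$. *)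

theory Defs
  imports Complex_Main "HOL-Library.Extended_Real"
begin

definition grid :: "nat \<Rightarrow> (int \<times> int) set" where
  "grid n = {0..int n} \<times> {0..int n}"

definition mesh :: "nat \<Rightarrow> real" where
  "mesh n = 1 / real n"

fun speed_at :: "(real \<times> real \<Rightarrow> real) \<Rightarrow> nat \<Rightarrow> int \<times> int \<Rightarrow> real" where
  "speed_at F n (i, j) = F (real_of_int i * mesh n, real_of_int j * mesh n)"

fun neighbors :: "nat \<Rightarrow> int \<times> int \<Rightarrow> (int \<times> int) set" where
  "neighbors n (i, j) = {(i - 1, j), (i + 1, j), (i, j - 1), (i, j + 1)} \<inter> grid n"


subsection \<open>The discrete eikonal equation\<close>

text \<open>Grid functions are real-valued and are continued by \<open>\<infinity>\<close> outside the grid; difference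
  quotients are therefore extended reals, and those reaching outside the grid equal \<open>- \<infinity>\<close>.\<close>

definition grid_ext :: "nat \<Rightarrow> (int \<times> int \<Rightarrow> real) \<Rightarrow> int \<times> int \<Rightarrow> ereal" where
  "grid_ext n T p = (if p \<in> grid n then ereal (T p) else \<infinity>)"

text \<open>\<open>neg_D_plus_x\<close> and \<open>neg_D_plus_y\<close> are the negated forward differences
  \<open>- D\<^sup>+\<^sup>x T\<close> and \<open>- D\<^sup>+\<^sup>y T\<close>.\<close>

fun D_minus_x :: "nat \<Rightarrow> (int \<times> int \<Rightarrow> real) \<Rightarrow> int \<times> int \<Rightarrow> ereal" where
  "D_minus_x n T (i, j) = (grid_ext n T (i, j) - grid_ext n T (i - 1, j)) / ereal (mesh n)"

fun neg_D_plus_x :: "nat \<Rightarrow> (int \<times> int \<Rightarrow> real) \<Rightarrow> int \<times> int \<Rightarrow> ereal" where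
  "neg_D_plus_x n T (i, j) = (grid_ext n T (i, j) - grid_ext n T (i + 1, j)) / ereal (mesh n)"

fun D_minus_y :: "nat \<Rightarrow> (int \<times> int \<Rightarrow> real) \<Rightarrow> int \<times> int \<Rightarrow> ereal" where
  "D_minus_y n T (i, j) = (grid_ext n T (i, j) - grid_ext n T (i, j - 1)) / ereal (mesh n)"

fun neg_D_plus_y :: "nat \<Rightarrow> (int \<times> int \<Rightarrow> real) \<Rightarrow> int \<times> int \<Rightarrow> ereal" where
  "neg_D_plus_y n T (i, j) = (grid_ext n T (i, j) - grid_ext n T (i, j + 1)) / ereal (mesh n)"

definition discrete_eikonal_solution ::
  "(real \<times> real \<Rightarrow> real) \<Rightarrow> nat \<Rightarrow> (int \<times> int) set \<Rightarrow> (int \<times> int) set \<Rightarrow> (int \<times> int \<Rightarrow> real) \<Rightarrow> bool"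
where
  "discrete_eikonal_solution F n \<Omega> \<Gamma> T \<longleftrightarrow>
     (\<forall>p\<in>\<Omega>. (max (max (D_minus_x n T p) (neg_D_plus_x n T p)) 0)\<^sup>2
           + (max (max (D_minus_y n T p) (neg_D_plus_y n T p)) 0)\<^sup>2
           = ereal (1 / (speed_at F n p)\<^sup>2)) \<and>
     (\<forall>p\<in>\<Gamma>. T p = 0)"


subsection \<open>Trial values\<close>

definition known_value :: "(int \<times> int) set \<Rightarrow> (int \<times> int \<Rightarrow> real) \<Rightarrow> int \<times> int \<Rightarrow> ereal" where
  "known_value K v p = (if p \<in> K then ereal (v p) else \<infinity>)"

fun trial_equation ::
  "(real \<times> real \<Rightarrow> real) \<Rightarrow> nat \<Rightarrow> (int \<times> int \<Rightarrow> ereal) \<Rightarrow> int \<times> int \<Rightarrow> real \<Rightarrow> bool"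
where
  "trial_equation F n a (k, l) X \<longleftrightarrow>
     (max (max (ereal X - a (k - 1, l)) (ereal X - a (k + 1, l))) 0)\<^sup>2
   + (max (max (ereal X - a (k, l - 1)) (ereal X - a (k, l + 1))) 0)\<^sup>2
   = ereal ((mesh n)\<^sup>2 / (speed_at F n (k, l))\<^sup>2)"

text \<open>The solution exists and is unique as soon as some neighbor is known; the algorithm below
  uses trial values only at such points.\<close>

definition trial_value ::
  "(real \<times> real \<Rightarrow> real) \<Rightarrow> nat \<Rightarrow> (int \<times> int) set \<Rightarrow> (int \<times> int \<Rightarrow> real) \<Rightarrow> int \<times> int \<Rightarrow> real"
where
  "trial_value F n K v p = (THE X. trial_equation F n (known_value K v) p X)"


subsection \<open>The modified fast marching method\<close>

text \<open>Only the buckets with index at most \<open>n\<^sub>B\<close> are ever used. The field \<open>ptr\<close> is the index \<open>s\<close>.\<close>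

record fmm_state =
  known :: "(int \<times> int) set"
  trial :: "(int \<times> int) set"
  val :: "int \<times> int \<Rightarrow> real"
  buckets :: "nat \<Rightarrow> (int \<times> int) list"
  ptr :: nat

definition bucket_no :: "nat \<Rightarrow> real \<Rightarrow> real \<Rightarrow> nat" where
  "bucket_no nB \<delta> t = nat (\<lfloor>t / \<delta>\<rfloor> mod (int nB + 1))"

definition enqueue ::
  "nat \<Rightarrow> real \<Rightarrow> (int \<times> int \<Rightarrow> real) \<Rightarrow> int \<times> int \<Rightarrow> (nat \<Rightarrow> (int \<times> int) list) \<Rightarrow> nat \<Rightarrow> (int \<times> int) list"
where
  "enqueue nB \<delta> v p B = (let r = bucket_no nB \<delta> (v p) in B(r := B r @ [p]))"

text \<open>The order in which several points are inserted at the same stage is left open: the list \<open>ps\<close>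
  (and likewise \<open>qs\<close> in the rule \<open>accept\<close> below) is an arbitrary enumeration of these points.\<close>

definition mfmm_init ::
  "(real \<times> real \<Rightarrow> real) \<Rightarrow> nat \<Rightarrow> (int \<times> int) set \<Rightarrow> (int \<times> int) set \<Rightarrow> nat \<Rightarrow> real \<Rightarrow> fmm_state \<Rightarrow> bool"
where
  "mfmm_init F n \<Omega> \<Gamma> nB \<delta> st \<longleftrightarrow>
     known st = \<Gamma> \<and>
     trial st = {p \<in> \<Omega>. neighbors n p \<inter> \<Gamma> \<noteq> {}} \<and>
     (\<forall>p\<in>\<Gamma>. val st p = 0) \<and>
     (\<forall>p\<in>trial st. val st p = trial_value F n \<Gamma> (val st) p) \<and>
     (\<exists>ps. distinct ps \<and> set ps = trial st \<and>
           buckets st = fold (enqueue nB \<delta> (val st)) ps (\<lambda>_. [])) \<and>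
     ptr st \<le> nB \<and>
     (\<forall>p\<in>trial st. (\<forall>q\<in>trial st. val st p \<le> val st q) \<longrightarrow> ptr st = bucket_no nB \<delta> (val st p))"

text \<open>The rules \<open>advance\<close> and \<open>skip\<close> are the search for the next point; \<open>accept\<close> performs one full
  iteration once an unknown point \<open>p\<close> has been found. There, \<open>Q\<close> is the set of neighbors of \<open>p\<close>
  that are trial once \<open>p\<close> is known and its unknown neighbors have been tagged, and \<open>qs\<close> lists those
  of them that are new in the narrow band or whose bucket number has changed. The premise
  \<open>trial st \<noteq> {}\<close> is the loop test on the narrow band.\<close>

inductive mfmm_step ::
  "(real \<times> real \<Rightarrow> real) \<Rightarrow> nat \<Rightarrow> nat \<Rightarrow> real \<Rightarrow> fmm_state \<Rightarrow> fmm_state \<Rightarrow> bool"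
  for F :: "real \<times> real \<Rightarrow> real" and n nB :: nat and \<delta> :: real
where
  advance:
    "\<lbrakk> trial st \<noteq> {}; buckets st (ptr st) = []; \<exists>r\<le>nB. buckets st r \<noteq> [] \<rbrakk>
     \<Longrightarrow> mfmm_step F n nB \<delta> st (st\<lparr>ptr := (ptr st + 1) mod (nB + 1)\<rparr>)"
| skip:
    "\<lbrakk> trial st \<noteq> {}; buckets st (ptr st) = p # ps; p \<in> known st \<rbrakk>
     \<Longrightarrow> mfmm_step F n nB \<delta> st (st\<lparr>buckets := (buckets st)(ptr st := ps)\<rparr>)"
| accept:
    "\<lbrakk> trial st \<noteq> {}; buckets st (ptr st) = p # ps; p \<notin> known st;
       K = insert p (known st);
       Q = neighbors n p - K;
       v = (\<lambda>q. if q \<in> Q then trial_value F n K (val st) q else val st q);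
       distinct qs;
       set qs = {q \<in> Q. q \<notin> trial st \<or> bucket_no nB \<delta> (v q) \<noteq> bucket_no nB \<delta> (val st q)} \<rbrakk>
     \<Longrightarrow> mfmm_step F n nB \<delta> st
           \<lparr>known = K, trial = (trial st - {p}) \<union> Q, val = v,
            buckets = fold (enqueue nB \<delta> v) qs ((buckets st)(ptr st := ps)),
            ptr = ptr st\<rparr>"

definition mfmm_terminated :: "nat \<Rightarrow> fmm_state \<Rightarrow> bool" where
  "mfmm_terminated nB st \<longleftrightarrow> trial st = {} \<or> (\<forall>r\<le>nB. buckets st r = [])"

text \<open>A computed grid function is prescribed only at the points that are known upon termination.\<close>

definition mfmm_computes ::
  "(real \<times> real \<Rightarrow> real) \<Rightarrow> nat \<Rightarrow> (int \<times> int) set \<Rightarrow> (int \<times> int) set \<Rightarrow> nat \<Rightarrow> real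
   \<Rightarrow> (int \<times> int \<Rightarrow> real) \<Rightarrow> bool"
where
  "mfmm_computes F n \<Omega> \<Gamma> nB \<delta> That \<longleftrightarrow>
     (\<exists>st0 st. mfmm_init F n \<Omega> \<Gamma> nB \<delta> st0 \<and> (mfmm_step F n nB \<delta>)\<^sup>*\<^sup>* st0 st \<and>
               mfmm_terminated nB st \<and> (\<forall>p\<in>known st. That p = val st p))"

end

theory Submission
  imports Defs
begin

text \<open>Write \<open>d\<close> for the bucket width. A trial value is the exact upwind value with respect to the
  points known so far, so it dominates the discrete solution by comparison. A point accepted after
  \<open>p\<close> comes from the same or a later bucket, hence its value is at least \<open>That p - d\<close>. Restoring all
  neighbors in the upwind equation at \<open>p\<close> therefore raises each directional slope to at most its
  maximum with \<open>d\<close>, and a factor \<open>1 - c\<close> with \<open>c = sqrt 2 * Fmax * d / h\<close> compensates this: \<open>(1 - c) * That\<close>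
  is a subsolution of the discrete equation and so lies below \<open>T\<close>. In particular the errors do not
  accumulate along the march.\<close>

declare split_paired_All [simp del] split_paired_Ex [simp del]

section \<open>The upwind operator\<close>

text \<open>The four candidates are not intersected with the grid. Clipping is left to the set
  \<open>K\<close> in \<open>slope\<close>, so one operator serves both the discrete equation (all
  grid points) and trial values (known points).\<close>

fun stencil :: "int \<times> int \<Rightarrow> (int \<times> int) set" where
  "stencil (i, j) = {(i - 1, j), (i + 1, j), (i, j - 1), (i, j + 1)}"

text \<open>A point outside \<open>K\<close> stands for the value infinity and gives slope 0.
  Truncating at 0 per neighbor keeps everything real.\<close>

definition slope :: "(int \<times> int) set \<Rightarrow> (int \<times> int \<Rightarrow> real) \<Rightarrow> real \<Rightarrow> int \<times> int \<Rightarrow> real" where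
  "slope K v X q = (if q \<in> K then max (X - v q) 0 else 0)"

fun upwind :: "(int \<times> int) set \<Rightarrow> (int \<times> int \<Rightarrow> real) \<Rightarrow> real \<Rightarrow> int \<times> int \<Rightarrow> real" where
  "upwind K v X (i, j) =
     (max (slope K v X (i - 1, j)) (slope K v X (i + 1, j)))\<^sup>2
   + (max (slope K v X (i, j - 1)) (slope K v X (i, j + 1)))\<^sup>2"

lemma slope_nonneg [simp]: "0 \<le> slope K v X q"
  by (simp add: slope_def)

lemma neighbors_eq_stencil: "neighbors n p = stencil p \<inter> grid n"
  by (cases p) simp

lemma stencil_sym: "q \<in> stencil p \<longleftrightarrow> p \<in> stencil q"
  by (cases p; cases q) auto

lemma finite_stencil [simp]: "finite (stencil p)"
  by (cases p) simp

lemma stencil_nonempty [simp]: "stencil p \<noteq> {}"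
  by (cases p) simp

section \<open>Reduction of both equations to the real upwind operator\<close>

lemma max_diff_known_value: "max (ereal X - known_value K v q) 0 = ereal (slope K v X q)"
  by (cases "q \<in> K") (simp_all add: known_value_def slope_def max_def)

lemma max_max_zero: "max (max a b) (0::'a::{linorder,zero}) = max (max a 0) (max b 0)"
  by (auto simp: max_def)

lemma trial_equation_iff:
  "trial_equation F n (known_value K v) p X \<longleftrightarrow> upwind K v X p = (mesh n / speed_at F n p)\<^sup>2"
proof -
  obtain i j where p: "p = (i, j)" by (cases p)
  show ?thesis
    unfolding p trial_equation.simps max_max_zero[of "_ - _" "_ - _"] max_diff_known_value
      ereal_max [symmetric] upwind.simps
    by (simp add: power_divide del: ereal_max)
qed

lemma max_quotient_known_value:
  assumes "h > 0"
  shows "max ((ereal X - known_value K v q) / ereal h) 0 = ereal (slope K v X q / h)"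
  using assms
  by (auto simp: known_value_def slope_def max_def zero_ereal_def field_simps
        divide_ereal_def)

lemma grid_ext_eq: "grid_ext n T = known_value (grid n) T"
  by (auto simp: grid_ext_def known_value_def)

text \<open>Multiplication by the squared mesh width. As \<open>p\<close> lies in the grid, the
  center value is finite, and each truncated quotient is a scaled \<open>slope\<close>.\<close>

lemma eikonal_equation_iff:
  assumes "p \<in> grid n" "n \<ge> 1"
  shows "(max (max (D_minus_x n T p) (neg_D_plus_x n T p)) 0)\<^sup>2
           + (max (max (D_minus_y n T p) (neg_D_plus_y n T p)) 0)\<^sup>2
           = ereal (1 / (speed_at F n p)\<^sup>2)
         \<longleftrightarrow> upwind (grid n) T (T p) p = (mesh n / speed_at F n p)\<^sup>2"
proof -
  obtain i j where p: "p = (i, j)" by (cases p)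
  have h: "mesh n > 0" using assms(2) by (simp add: mesh_def)
  have gp: "known_value (grid n) T (i, j) = ereal (T p)"
    using assms p by (simp add: known_value_def)
  have mx: "max (a / mesh n) (b / mesh n) = max a b / mesh n" for a b :: real
    using h by (auto simp: max_def divide_right_mono field_simps)
  have "(a / mesh n)\<^sup>2 + (b / mesh n)\<^sup>2 = 1 / (speed_at F n p)\<^sup>2
        \<longleftrightarrow> a\<^sup>2 + b\<^sup>2 = (mesh n / speed_at F n p)\<^sup>2" for a b :: real
    using h by (simp add: power_divide add_divide_distrib [symmetric] field_simps)
  then show ?thesis
    unfolding p D_minus_x.simps neg_D_plus_x.simps D_minus_y.simps neg_D_plus_y.simps
      grid_ext_eq gp max_max_zero[of "_ / _" "_ / _"] max_quotient_known_value[OF h]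
      ereal_max [symmetric] mx upwind.simps
    by (simp add: p del: ereal_max)
qed

section \<open>Monotonicity, comparison, uniqueness and existence\<close>

lemma max_power2_strict_mono:
  fixes a b a' b' :: real
  assumes "0 \<le> a" "0 \<le> b" "0 < a \<Longrightarrow> a < a'" "0 < b \<Longrightarrow> b < b'" "0 \<le> a'" "0 \<le> b'"
  shows "(max a b)\<^sup>2 \<le> (max a' b')\<^sup>2" "0 < (max a b)\<^sup>2 \<Longrightarrow> (max a b)\<^sup>2 < (max a' b')\<^sup>2"
proof -
  have *: "max a b = 0 \<or> max a b < max a' b'"
    using assms by (cases "a = 0"; cases "b = 0") (auto simp: less_max_iff_disj max_def)
  then show "(max a b)\<^sup>2 \<le> (max a' b')\<^sup>2"
    using assms by (auto intro!: power_mono simp: le_max_iff_disj)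
  show "(max a b)\<^sup>2 < (max a' b')\<^sup>2" if "0 < (max a b)\<^sup>2"
  proof -
    have "max a b < max a' b'" using * that by auto
    then show ?thesis using assms by (intro power_strict_mono) (auto simp: le_max_iff_disj)
  qed
qed

text \<open>Slopes that vanish need not grow: a directional maximum that is positive is attained at
  a positive slope, and a positive sum contains a positive square.\<close>

lemma upwind_strict_mono:
  assumes "\<And>q. q \<in> stencil p \<Longrightarrow> 0 < slope K v X q \<Longrightarrow> slope K v X q < slope K' v' X' q"
    and "0 < upwind K v X p"
  shows "upwind K v X p < upwind K' v' X' p"
proof -
  obtain i j where p: "p = (i, j)" by (cases p)
  have s: "0 < slope K v X q \<Longrightarrow> slope K v X q < slope K' v' X' q"
    if "q \<in> {(i - 1, j), (i + 1, j), (i, j - 1), (i, j + 1)}" for q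
    using assms(1) that p by simp
  let ?x = "(max (slope K v X (i - 1, j)) (slope K v X (i + 1, j)))\<^sup>2"
  let ?y = "(max (slope K v X (i, j - 1)) (slope K v X (i, j + 1)))\<^sup>2"
  let ?x' = "(max (slope K' v' X' (i - 1, j)) (slope K' v' X' (i + 1, j)))\<^sup>2"
  let ?y' = "(max (slope K' v' X' (i, j - 1)) (slope K' v' X' (i, j + 1)))\<^sup>2"
  have "?x \<le> ?x'" "0 < ?x \<Longrightarrow> ?x < ?x'" "?y \<le> ?y'" "0 < ?y \<Longrightarrow> ?y < ?y'"
    by (rule max_power2_strict_mono; simp add: s)+
  moreover have "0 < ?x + ?y"
    using assms(2) by (simp add: p)
  moreover have "0 \<le> ?x" "0 \<le> ?y" by simp_all
  ultimately have "?x + ?y < ?x' + ?y'" by linarith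
  then show ?thesis by (simp add: p)
qed

text \<open>If \<open>X < X'\<close>, every contributing neighbor contributes strictly more to the
  second operator. Only neighbors below \<open>X\<close> have to be compared; this causality later
  permits minimal-counterexample arguments.\<close>

lemma upwind_comparison:
  assumes "upwind K v X p = r" "upwind K' v' X' p \<le> r" "0 < r"
    and "\<And>q. q \<in> stencil p \<Longrightarrow> q \<in> K \<Longrightarrow> v q < X \<Longrightarrow> q \<in> K' \<and> v' q \<le> v q"
  shows "X' \<le> X"
proof (rule ccontr)
  assume "\<not> X' \<le> X"
  then have "upwind K v X p < upwind K' v' X' p"
    using assms(1,3,4)
    by (intro upwind_strict_mono) (fastforce simp: slope_def split: if_splits)+
  then show False using assms by simp
qed

lemma upwind_unique:
  assumes "upwind K v X p = r" "upwind K v Y p = r" "0 < r"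
  shows "X = Y"
proof (rule antisym)
  show "X \<le> Y"
    by (rule upwind_comparison[OF assms(2) _ assms(3), of K v]) (simp_all add: assms(1))
  show "Y \<le> X"
    by (rule upwind_comparison[OF assms(1) _ assms(3), of K v]) (simp_all add: assms(2))
qed

lemma slope_power2_le_upwind:
  assumes "q \<in> stencil p"
  shows "(slope K v X q)\<^sup>2 \<le> upwind K v X p"
proof -
  obtain i j where p: "p = (i, j)" by (cases p)
  have *: "(slope K v X a)\<^sup>2 \<le> (max (slope K v X a) (slope K v X b))\<^sup>2"
    "(slope K v X b)\<^sup>2 \<le> (max (slope K v X a) (slope K v X b))\<^sup>2" for a b
    by (auto intro!: power_mono)
  show ?thesis
    using assms unfolding p
    by (auto intro: add_increasing[OF zero_le_power2 *(1)] add_increasing[OF zero_le_power2 *(2)]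
        add_increasing2[OF zero_le_power2 *(1)] add_increasing2[OF zero_le_power2 *(2)])
qed

lemma upwind_upper_bound:
  assumes "upwind K v X p = r\<^sup>2" "0 \<le> r" "q \<in> stencil p" "q \<in> K"
  shows "X \<le> v q + r"
proof -
  have "slope K v X q \<le> r"
    using slope_power2_le_upwind[OF assms(3), of K v X] assms(1,2)
    by (simp add: power2_le_iff_abs_le)
  then show ?thesis using assms(4) by (simp add: slope_def)
qed

lemma upwind_lower_neighbor:
  assumes "0 < upwind K v X p"
  obtains q where "q \<in> stencil p" "q \<in> K" "v q < X"
proof -
  have "\<exists>q\<in>stencil p. slope K v X q \<noteq> 0"
  proof (rule ccontr)
    assume "\<not> ?thesis"
    then have "upwind K v X p = 0" by (cases p) simp
    then show False using assms by simp
  qed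
  then show ?thesis using that by (force simp: slope_def split: if_splits)
qed

text \<open>Intermediate value theorem between the minimum over the stencil, where all slopes
  vanish, and \<open>v q + r\<close>, where the slope towards \<open>q\<close> alone reaches the
  right side.\<close>

lemma upwind_exists:
  assumes "q \<in> stencil p" "q \<in> K" "0 \<le> r"
  shows "\<exists>X. upwind K v X p = r\<^sup>2"
proof -
  define lo where "lo = Min (v ` stencil p)"
  have lo: "lo \<le> v a" if "a \<in> stencil p" for a
    using that by (simp add: lo_def)
  have "slope K v lo a = 0" if "a \<in> stencil p" for a
    using lo[OF that] by (simp add: slope_def)
  then have "upwind K v lo p = 0" by (cases p) simp
  moreover have "r\<^sup>2 \<le> upwind K v (v q + r) p"
    using slope_power2_le_upwind[OF assms(1), of K v "v q + r"] assms by (simp add: slope_def)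
  moreover have "isCont (\<lambda>X. upwind K v X p) x" for x
  proof -
    have "isCont (\<lambda>X. slope K v X a) x" for a
      by (cases "a \<in> K") (auto simp: slope_def intro!: continuous_intros)
    then show ?thesis by (cases p) (auto intro!: continuous_intros)
  qed
  ultimately show ?thesis
    using IVT[of "\<lambda>X. upwind K v X p" lo "r\<^sup>2" "v q + r"] lo[OF assms(1)] assms(3) by auto
qed

lemma upwind_trial_value:
  assumes "q \<in> stencil p" "q \<in> K" "0 < mesh n / speed_at F n p"
  shows "upwind K v (trial_value F n K v p) p = (mesh n / speed_at F n p)\<^sup>2"
proof -
  obtain X where X: "upwind K v X p = (mesh n / speed_at F n p)\<^sup>2"
    using upwind_exists[OF assms(1,2), of "mesh n / speed_at F n p" v] assms(3) by auto
  then have "trial_value F n K v p = X"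
    unfolding trial_value_def trial_equation_iff
    by (rule the_equality)
       (use X upwind_unique[OF _ X] assms(3) zero_less_power[of "mesh n / speed_at F n p" 2] in blast)+
  then show ?thesis using X by simp
qed

lemma upwind_cong:
  assumes "\<And>q. q \<in> stencil p \<Longrightarrow> q \<in> K \<longleftrightarrow> q \<in> K'"
    and "\<And>q. q \<in> stencil p \<Longrightarrow> q \<in> K \<Longrightarrow> v q = v' q"
  shows "upwind K v X p = upwind K' v' X p"
proof -
  have "slope K v X q = slope K' v' X q" if "q \<in> stencil p" for q
    using assms(1)[OF that] assms(2)[OF that] by (simp add: slope_def)
  then show ?thesis by (cases p) simp
qed

text \<open>If \<open>p\<close> is not below \<open>Y\<close>, it has slope 0 at \<open>Y\<close>,
  so \<open>Y\<close> already solves the old equation and uniqueness applies. Hence a value that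
  really changes stays above that of the inserted point.\<close>

lemma upwind_insert:
  assumes "upwind K v X q = r" "upwind (insert p K) v Y q = r" "0 < r"
  shows "Y \<le> X" "v p < Y \<or> Y = X"
proof -
  show "Y \<le> X"
    by (rule upwind_comparison[OF assms(1) _ assms(3), of "insert p K" v]) (simp_all add: assms(2))
  show "v p < Y \<or> Y = X"
  proof (cases "v p < Y")
    case False
    then have "slope K v Y a = slope (insert p K) v Y a" for a
      by (simp add: slope_def)
    then have "upwind K v Y q = upwind (insert p K) v Y q"
      by (cases q) simp
    then show ?thesis using upwind_unique[OF assms(1) _ assms(3), of Y] assms(2) by simp
  qed auto
qed


section \<open>Damping\<close>

text \<open>Here \<open>x\<close> and \<open>y\<close> are the directional slopes of a solved
  equation, and \<open>d\<close> bounds the slope added by points ignored at that time. The sum of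
  squares grows by at most \<open>d\<^sup>2\<close>, which is at most
  \<open>c\<^sup>2 * r\<^sup>2 / 2\<close>.\<close>

lemma damping_inequality:
  fixes x y d r c :: real
  assumes "x\<^sup>2 + y\<^sup>2 = r\<^sup>2" "0 \<le> x" "0 \<le> y" "0 < r" "0 < d" "sqrt 2 * d \<le> c * r" "c < 1"
  shows "(1 - c)\<^sup>2 * ((max x d)\<^sup>2 + (max y d)\<^sup>2) \<le> r\<^sup>2"
proof -
  have "0 < c * r" using assms by (smt (verit) mult_pos_pos real_sqrt_gt_zero)
  then have c: "0 < c" using assms(4) zero_less_mult_pos2 by blast
  have "(sqrt 2 * d)\<^sup>2 \<le> (c * r)\<^sup>2" using assms by (intro power_mono) auto
  then have d2: "2 * d\<^sup>2 \<le> c\<^sup>2 * r\<^sup>2" by (simp add: power_mult_distrib)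
  have "(1 - c)\<^sup>2 \<le> 1" using c assms(7) by (simp add: power_le_one)
  have c2: "c\<^sup>2 \<le> 1" using c assms(7) by (simp add: power_le_one)
  have "c\<^sup>2 * r\<^sup>2 \<le> 1 * r\<^sup>2" using c2 by (intro mult_right_mono) auto
  then have dd: "2 * d\<^sup>2 \<le> r\<^sup>2" using d2 by simp
  have xy: "x\<^sup>2 \<le> r\<^sup>2" "y\<^sup>2 \<le> r\<^sup>2" using assms(1) zero_le_power2[of x] zero_le_power2[of y] by linarith+
  \<comment> \<open>If both maxima equal \<open>d\<close>, the sum is \<open>2 * d\<^sup>2\<close>,
    at most \<open>r\<^sup>2\<close>; if only one does, the other square is still at most
    \<open>r\<^sup>2\<close>.\<close>
  have "(max x d)\<^sup>2 + (max y d)\<^sup>2 \<le> r\<^sup>2 + d\<^sup>2"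
    using assms(1) xy dd by (auto simp: max_def)
  then have *: "(max x d)\<^sup>2 + (max y d)\<^sup>2 \<le> r\<^sup>2 * (1 + c\<^sup>2 / 2)" using d2 by (simp add: field_simps)
  have "(1 - c)\<^sup>2 * (1 + c\<^sup>2 / 2) \<le> 1"
  proof -
    have "(1 - c)\<^sup>2 \<le> 1 - c"
      using c assms(7) by (simp add: power2_eq_square field_simps)
    moreover have "1 + c\<^sup>2 / 2 \<le> 1 + c" 
      using c assms(7) by (simp add: power2_eq_square field_simps mult_left_le)
    ultimately have "(1 - c)\<^sup>2 * (1 + c\<^sup>2 / 2) \<le> (1 - c) * (1 + c)"
      using c assms(7) by (intro mult_mono) auto
    also have "\<dots> \<le> 1" by (simp add: algebra_simps)
    finally show ?thesis .
  qed
  then have "r\<^sup>2 * ((1 - c)\<^sup>2 * (1 + c\<^sup>2 / 2)) \<le> r\<^sup>2 * 1"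
    by (intro mult_left_mono) auto
  moreover have "(1 - c)\<^sup>2 * ((max x d)\<^sup>2 + (max y d)\<^sup>2) \<le> (1 - c)\<^sup>2 * (r\<^sup>2 * (1 + c\<^sup>2 / 2))"
    using * by (intro mult_left_mono) auto
  ultimately show ?thesis by (simp add: algebra_simps)
qed

lemma slope_scale:
  assumes "0 \<le> a"
  shows "slope K (\<lambda>q. a * v q) (a * X) q = a * slope K v X q"
  using assms max_mult_distrib_left[of a "X - v q" 0] by (simp add: slope_def right_diff_distrib)

lemma upwind_scale:
  assumes "0 \<le> a"
  shows "upwind K (\<lambda>q. a * v q) (a * X) p = a\<^sup>2 * upwind K v X p"
proof -
  have "max (a * x) (a * y) = a * max x y" for x y
    using assms by (simp add: max_mult_distrib_left)
  then show ?thesis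
    by (cases p) (simp add: slope_scale[OF assms] power_mult_distrib distrib_left)
qed

text \<open>A neighbor in \<open>K' - K\<close> is no lower than \<open>X - d\<close>, so its slope
  is at most \<open>d\<close>. Homogeneity of degree two then pulls out the factor
  \<open>1 - c\<close>.\<close>

lemma upwind_damped:
  assumes "upwind K v X p = r\<^sup>2" "0 < r" "0 < d" "sqrt 2 * d \<le> c * r" "c < 1"
    and "\<And>q. q \<in> K' - K \<Longrightarrow> X - d \<le> v q"
  shows "upwind K' (\<lambda>q. (1 - c) * v q) ((1 - c) * X) p \<le> r\<^sup>2"
proof -
  obtain i j where p: "p = (i, j)" by (cases p)
  let ?x = "max (slope K v X (i - 1, j)) (slope K v X (i + 1, j))"
  let ?y = "max (slope K v X (i, j - 1)) (slope K v X (i, j + 1))"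
  have s: "slope K' v X q \<le> max (slope K v X q) d" for q
    using assms(3) assms(6)[of q] by (auto simp: slope_def max_def)
  have m: "(max (slope K' v X a) (slope K' v X b))\<^sup>2
      \<le> (max (max (slope K v X a) (slope K v X b)) d)\<^sup>2" for a b
    using s[of a] s[of b] by (intro power_mono) (auto simp: le_max_iff_disj)
  have "upwind K' v X p \<le> (max ?x d)\<^sup>2 + (max ?y d)\<^sup>2"
    unfolding p upwind.simps by (intro add_mono m)
  then have "(1 - c)\<^sup>2 * upwind K' v X p \<le> (1 - c)\<^sup>2 * ((max ?x d)\<^sup>2 + (max ?y d)\<^sup>2)"
    by (intro mult_left_mono) auto
  also have "\<dots> \<le> r\<^sup>2"
    using assms p by (intro damping_inequality) (auto simp: le_max_iff_disj)
  finally show ?thesis using assms(5) by (simp add: upwind_scale)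
qed


section \<open>Grid connectivity\<close>

lemma int_interval_connected:
  fixes a :: int
  assumes "a \<in> A" "a \<in> {0..m}" "\<And>i j. i \<in> A \<Longrightarrow> j \<in> {i - 1, i + 1} \<Longrightarrow> j \<in> {0..m} \<Longrightarrow> j \<in> A"
  shows "{0..m} \<subseteq> A"
proof
  fix x assume x: "x \<in> {0..m}"
  show "x \<in> A"
  proof (cases "a \<le> x")
    case True
    then have "x \<le> m \<longrightarrow> x \<in> A"
      by (induction x rule: int_ge_induct) (use assms in auto)
    then show ?thesis using x by simp
  next
    case False
    then have "x \<le> a" by simp
    then have "0 \<le> x \<longrightarrow> x \<in> A"
      by (induction x rule: int_le_induct) (use assms in auto)
    then show ?thesis using x by simp
  qed
qed

text \<open>Fill the line through \<open>p\<close> in the first coordinate, then from each of its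
  points the line in the second. Applied to the known set upon termination.\<close>

lemma grid_connected:
  assumes "p \<in> K" "p \<in> grid n" "\<And>q. q \<in> K \<Longrightarrow> neighbors n q \<subseteq> K"
  shows "grid n \<subseteq> K"
proof -
  obtain a b where p: "p = (a, b)" by (cases p)
  have ab: "a \<in> {0..int n}" "b \<in> {0..int n}" using assms(2) p by (auto simp: grid_def)
  have step: "r \<in> K" if "q \<in> K" "r \<in> stencil q" "r \<in> grid n" for q r
    using assms(3)[OF that(1)] that(2,3) by (auto simp: neighbors_eq_stencil)
  have row: "{0..int n} \<subseteq> {i. (i, b) \<in> K}"
  proof (rule int_interval_connected[of a])
    show "j \<in> {i. (i, b) \<in> K}"
      if "i \<in> {i. (i, b) \<in> K}" "j \<in> {i - 1, i + 1}" "j \<in> {0..int n}" for i j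
      using step[of "(i, b)" "(j, b)"] that ab by (auto simp: grid_def)
  qed (use assms(1) p ab in auto)
  have "{0..int n} \<subseteq> {j. (i, j) \<in> K}" if i: "i \<in> {0..int n}" for i
  proof (rule int_interval_connected[of b])
    show "l \<in> {j. (i, j) \<in> K}"
      if "j \<in> {j. (i, j) \<in> K}" "l \<in> {j - 1, j + 1}" "l \<in> {0..int n}" for j l
      using step[of "(i, j)" "(i, l)"] that i by (auto simp: grid_def)
  qed (use row i ab in auto)
  then show ?thesis by (fastforce simp: grid_def)
qed


section \<open>Buckets\<close>

text \<open>Levels are unreduced integers, ordered like the values; \<open>slot\<close> passes to
  the cyclic array index.\<close>

definition slot :: "nat \<Rightarrow> int \<Rightarrow> nat" where
  "slot nB j = nat (j mod (int nB + 1))"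

lemma bucket_no_eq_slot: "bucket_no nB d t = slot nB \<lfloor>t / d\<rfloor>"
  by (simp add: bucket_no_def slot_def)

lemma slot_le: "slot nB j \<le> nB"
  using pos_mod_bound[of "int nB + 1" j] by (simp add: slot_def)

text \<open>The levels are congruent modulo \<open>nB + 1\<close> but closer than the
  modulus.\<close>

lemma slot_inj:
  assumes "slot nB i = slot nB j" "s \<le> i" "i \<le> s + int nB" "s \<le> j" "j \<le> s + int nB"
  shows "i = j"
proof -
  have "i mod (int nB + 1) = j mod (int nB + 1)"
    using assms(1) by (simp add: slot_def eq_nat_nat_iff)
  then have "(i - j) mod (int nB + 1) = 0" by (simp add: mod_eq_dvd_iff)
  then have "int nB + 1 dvd i - j" by auto
  then show ?thesis using assms zdvd_imp_le[of "int nB + 1" "i - j"] zdvd_imp_le[of "int nB + 1" "j - i"]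
    by (smt (verit) dvd_diff_commute)
qed

lemma slot_succ: "slot nB (s + 1) = (slot nB s + 1) mod (nB + 1)"
proof -
  have "int (slot nB (s + 1)) = int ((slot nB s + 1) mod (nB + 1))"
    by (simp add: slot_def zmod_int mod_simps add.commute)
  then show ?thesis by linarith
qed

text \<open>The level entering the window when the pointer moves up reuses the bucket of the level
  that leaves it.\<close>

lemma slot_wrap: "slot nB (s + int nB + 1) = slot nB s"
proof -
  have "(s + (int nB + 1)) mod (int nB + 1) = s mod (int nB + 1)" by (rule mod_add_self2)
  then show ?thesis by (simp add: slot_def add.assoc)
qed

lemma set_fold_enqueue:
  "set (fold (enqueue nB d v) ps B r) = set (B r) \<union> {p \<in> set ps. bucket_no nB d (v p) = r}"
  by (induction ps arbitrary: B) (auto simp: enqueue_def Let_def)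


section \<open>The marching invariant\<close>

lemma finite_grid [simp]: "finite (grid n)"
  by (simp add: grid_def)

locale fast_marching =
  fixes F :: "real \<times> real \<Rightarrow> real"
    and Fmin Fmax \<delta> :: real
    and n nB :: nat
    and \<Omega> \<Gamma> :: "(int \<times> int) set"
    and T :: "int \<times> int \<Rightarrow> real"
  assumes n: "n \<ge> 1"
    and Fmin: "0 < Fmin"
    and speed: "\<And>p. p \<in> grid n \<Longrightarrow> Fmin \<le> speed_at F n p \<and> speed_at F n p \<le> Fmax"
    and cover: "\<Omega> \<union> \<Gamma> = grid n"
    and disjoint: "\<Omega> \<inter> \<Gamma> = {}"
    and nonempty: "\<Gamma> \<noteq> {}"
    and nB: "nB \<ge> 1"
    and delta: "\<delta> = mesh n / (Fmin * real nB)"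
    and eikonal: "discrete_eikonal_solution F n \<Omega> \<Gamma> T"
begin

section \<open>Scales: local cost, bucket width, levels\<close>

abbreviation cost :: "int \<times> int \<Rightarrow> real" where
  "cost p \<equiv> mesh n / speed_at F n p"

abbreviation level :: "real \<Rightarrow> int" where
  "level t \<equiv> \<lfloor>t / \<delta>\<rfloor>"

lemma mesh_pos: "0 < mesh n"
  using n by (simp add: mesh_def)

lemma delta_pos: "0 < \<delta>"
  using mesh_pos Fmin nB by (simp add: delta)

lemma cost_pos: "p \<in> grid n \<Longrightarrow> 0 < cost p"
  using mesh_pos Fmin speed[of p] by simp

text \<open>\<open>real nB * \<delta>\<close> equals \<open>mesh n / Fmin\<close>, the largest cost
  the speed bounds allow.\<close>

lemma cost_le: "p \<in> grid n \<Longrightarrow> cost p \<le> real nB * \<delta>"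
  using mesh_pos Fmin speed[of p] nB by (simp add: delta frac_le)

lemma level_mono: "s \<le> t \<Longrightarrow> level s \<le> level t"
  using delta_pos by (intro floor_mono divide_right_mono) auto

text \<open>The shift is a whole number of widths, so flooring costs no extra level and
  \<open>nB + 1\<close> buckets suffice.\<close>

lemma level_add_nB: "level (t + real nB * \<delta>) = level t + int nB"
proof -
  have "(t + real nB * \<delta>) / \<delta> = t / \<delta> + of_int (int nB)"
    using delta_pos by (simp add: field_simps)
  then show ?thesis by (simp only: floor_add_int)
qed

text \<open>The source of the error: values in one bucket may be accepted in the wrong order, but
  they differ by less than one width.\<close>

lemma level_le_imp: "level s \<le> level t \<Longrightarrow> s - \<delta> \<le> t"
proof -
  assume "level s \<le> level t"
  then have "s / \<delta> < t / \<delta> + 1" by linarith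
  then show ?thesis using delta_pos by (simp add: field_simps)
qed

section \<open>Positivity and comparison for the discrete solution\<close>

lemma upwind_T: "p \<in> \<Omega> \<Longrightarrow> upwind (grid n) T (T p) p = (cost p)\<^sup>2"
  using eikonal cover n eikonal_equation_iff[of p n T F]
  by (auto simp: discrete_eikonal_solution_def)

lemma T_boundary: "p \<in> \<Gamma> \<Longrightarrow> T p = 0"
  using eikonal by (auto simp: discrete_eikonal_solution_def)

lemma T_lower_neighbor:
  assumes "p \<in> \<Omega>"
  obtains q where "q \<in> grid n" "T q < T p"
proof -
  have "p \<in> grid n" using assms cover by auto
  then have "0 < upwind (grid n) T (T p) p"
    using upwind_T[OF assms] cost_pos by (metis zero_less_power)
  then show ?thesis using upwind_lower_neighbor that by metis
qed

text \<open>Every point of \<open>\<Omega>\<close> has a strictly lower grid point, so the minimum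
  is attained on \<open>\<Gamma>\<close>, where it is 0.\<close>

lemma T_nonneg: "p \<in> grid n \<Longrightarrow> 0 \<le> T p"
proof -
  assume p: "p \<in> grid n"
  define m where "m = arg_min_on T (grid n)"
  have m: "m \<in> grid n" "\<not> (\<exists>x\<in>grid n. T x < T m)"
    unfolding m_def using p by (intro arg_min_if_finite; auto)+
  then have "m \<notin> \<Omega>" using T_lower_neighbor by metis
  then have "T m = 0" using m(1) cover T_boundary[of m] by auto
  then show ?thesis using m(2) p by (metis not_le)
qed

lemma T_pos: "p \<in> \<Omega> \<Longrightarrow> 0 < T p"
  by (meson T_lower_neighbor T_nonneg le_less_trans)

text \<open>Choose the counterexample minimizing \<open>T\<close>, not one maximizing
  \<open>S - T\<close>. All grid points with smaller \<open>T\<close> satisfy the claim, and the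
  comparison at \<open>m\<close> inspects no others.\<close>

lemma subsolution_le:
  assumes "\<And>p. p \<in> \<Gamma> \<Longrightarrow> S p \<le> 0"
    and "\<And>p. p \<in> \<Omega> \<Longrightarrow> upwind (grid n) S (S p) p \<le> (cost p)\<^sup>2"
    and "p \<in> grid n"
  shows "S p \<le> T p"
proof (rule ccontr)
  define C where "C = {q \<in> grid n. T q < S q}"
  define m where "m = arg_min_on T C"
  assume "\<not> S p \<le> T p"
  then have "p \<in> C" using assms(3) by (simp add: C_def)
  then have C: "finite C" "C \<noteq> {}" by (auto simp: C_def)
  have m: "m \<in> C" "\<not> (\<exists>x\<in>C. T x < T m)"
    unfolding m_def using arg_min_if_finite[OF C, of T] by auto
  have "m \<in> grid n" "T m < S m" using m(1) by (auto simp: C_def)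
  moreover have "m \<notin> \<Gamma>" using assms(1) T_boundary \<open>T m < S m\<close> by fastforce
  ultimately have "m \<in> \<Omega>" using cover by auto
  have "S m \<le> T m"
  proof (rule upwind_comparison[OF upwind_T assms(2)])
    show "0 < (cost m)\<^sup>2" using cost_pos[OF \<open>m \<in> grid n\<close>] by (rule zero_less_power)
    show "q \<in> grid n \<and> S q \<le> T q" if "q \<in> grid n" "T q < T m" for q
    proof -
      have "q \<notin> C" using m(2) that(2) by auto
      then show ?thesis using that(1) by (auto simp: C_def)
    qed
  qed fact+
  then show False using \<open>T m < S m\<close> by simp
qed

text \<open>In the last clause, \<open>K0\<close> is the set of known points at the moment \<open>p\<close> was accepted.\<close>

definition march_inv ::
  "(int \<times> int) set \<Rightarrow> (int \<times> int) set \<Rightarrow> (int \<times> int \<Rightarrow> real) \<Rightarrow> bool" where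
  "march_inv K N v \<longleftrightarrow>
     \<Gamma> \<subseteq> K \<and> K \<subseteq> grid n \<and> N \<subseteq> grid n - K \<and>
     (\<forall>p\<in>K. neighbors n p \<subseteq> K \<union> N) \<and>
     (\<forall>p\<in>N. stencil p \<inter> K \<noteq> {} \<and> upwind K v (v p) p = (cost p)\<^sup>2) \<and>
     (\<forall>p\<in>\<Gamma>. v p = 0) \<and>
     (\<forall>p\<in>K. T p \<le> v p) \<and>
     (\<forall>p\<in>K - \<Gamma>. \<exists>K0\<subseteq>K. upwind K0 v (v p) p = (cost p)\<^sup>2 \<and> (\<forall>q\<in>K - K0. v p - \<delta> \<le> v q))"

lemma march_invD:
  assumes "march_inv K N v"
  shows "\<Gamma> \<subseteq> K" "K \<subseteq> grid n" "N \<subseteq> grid n" "p \<in> N \<Longrightarrow> p \<notin> K"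
    and "p \<in> K \<Longrightarrow> neighbors n p \<subseteq> K \<union> N"
    and "p \<in> N \<Longrightarrow> stencil p \<inter> K \<noteq> {}"
    and "p \<in> N \<Longrightarrow> upwind K v (v p) p = (cost p)\<^sup>2"
    and "p \<in> \<Gamma> \<Longrightarrow> v p = 0"
    and "p \<in> K \<Longrightarrow> T p \<le> v p"
    and "p \<in> K \<Longrightarrow> p \<notin> \<Gamma> \<Longrightarrow>
       \<exists>K0\<subseteq>K. upwind K0 v (v p) p = (cost p)\<^sup>2 \<and> (\<forall>q\<in>K - K0. v p - \<delta> \<le> v q)"
  using assms unfolding march_inv_def by blast+

text \<open>\<open>X\<close> is the value recomputed at \<open>q\<close> after \<open>p\<close> is
  accepted. The second claim keeps it inside the window above \<open>v p\<close>, the third makes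
  trial values decrease, the last prevents new values from falling behind the pointer.\<close>

lemma accept_values:
  assumes inv: "march_inv K N v" and p: "p \<in> N"
    and q: "q \<in> neighbors n p - insert p K"
    and X: "X = trial_value F n (insert p K) v q"
  shows "upwind (insert p K) v X q = (cost q)\<^sup>2"
    and "X \<le> v p + real nB * \<delta>"
    and "q \<in> N \<Longrightarrow> X \<le> v q"
    and "v p < X \<or> q \<in> N \<and> X = v q"
proof -
  note D = march_invD[OF inv]
  have qg: "q \<in> grid n" and pq: "p \<in> stencil q" and qK: "q \<notin> K"
    using q by (auto simp: neighbors_eq_stencil stencil_sym)
  have c: "0 < (cost q)\<^sup>2" using cost_pos[OF qg] by (rule zero_less_power)
  show up: "upwind (insert p K) v X q = (cost q)\<^sup>2"
    unfolding X using pq cost_pos[OF qg] by (intro upwind_trial_value) auto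
  show "X \<le> v p + real nB * \<delta>"
    using upwind_upper_bound[OF up _ pq] cost_pos[OF qg] cost_le[OF qg] by force
  show "X \<le> v q" if "q \<in> N"
    using upwind_insert(1)[OF D(7)[OF that] up c] .
  show "v p < X \<or> q \<in> N \<and> X = v q"
  proof (cases "q \<in> N")
    case True
    then show ?thesis using upwind_insert(2)[OF D(7)[OF True] up c] by auto
  next
    case False
    obtain k where k: "k \<in> stencil q" "k \<in> insert p K" "v k < X"
      using upwind_lower_neighbor[of "insert p K" v X q] up c by metis
    \<comment> \<open>Neighbors of known points are known or trial, so a point new to the band has
      \<open>p\<close> as its only known neighbor.\<close>
    have "k \<notin> K"
    proof
      assume "k \<in> K"
      moreover have "q \<in> neighbors n k"
        using k(1) qg by (simp add: neighbors_eq_stencil stencil_sym)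
      ultimately show False using D(5)[of k] False qK by auto
    qed
    then show ?thesis using k by auto
  qed
qed

text \<open>The hypothesis \<open>late\<close> is all that the queue order contributes. It extends
  the last clause of the invariant, for points accepted earlier, to the new point
  \<open>p\<close>.\<close>

lemma march_inv_accept:
  assumes inv: "march_inv K N v" and p: "p \<in> N"
    and late: "\<And>q. q \<in> K \<Longrightarrow> v q - \<delta> \<le> v p"
    and K': "K' = insert p K"
    and Q: "Q = neighbors n p - K'"
    and w: "w = (\<lambda>q. if q \<in> Q then trial_value F n K' v q else v q)"
  shows "march_inv K' (N - {p} \<union> Q) w"
proof -
  note D = march_invD[OF inv]
  have wK: "w q = v q" if "q \<in> K'" for q using that Q by (simp add: w)
  have up_w: "upwind M w X q = upwind M v X q" if "M \<subseteq> K'" for M X q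
    using that wK by (intro upwind_cong) auto
  have pO: "p \<in> \<Omega>" using D(1,3,4) p cover by blast
  have pg: "p \<in> grid n" using D(3) p by auto
  show ?thesis
    unfolding march_inv_def
  proof (intro conjI ballI)
    show "\<Gamma> \<subseteq> K'" "K' \<subseteq> grid n" using D(1,2) pg K' by auto
    show "N - {p} \<union> Q \<subseteq> grid n - K'"
      using D(3,4) K' Q by (auto simp: neighbors_eq_stencil)
  next
    fix q assume "q \<in> K'"
    then show "neighbors n q \<subseteq> K' \<union> (N - {p} \<union> Q)" using D(5)[of q] K' Q by auto
  next
    fix q assume q: "q \<in> N - {p} \<union> Q"
    show "stencil q \<inter> K' \<noteq> {}"
    proof (cases "q \<in> Q")
      case True
      then have "p \<in> stencil q" using Q by (auto simp: neighbors_eq_stencil stencil_sym)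
      then show ?thesis using K' by auto
    next
      case False
      then show ?thesis using q D(6)[of q] K' by auto
    qed
    show "upwind K' w (w q) q = (cost q)\<^sup>2"
    proof (cases "q \<in> Q")
      case True
      then show ?thesis
        using accept_values(1)[OF inv p, of q, folded K', OF _ refl] Q
        by (subst up_w) (simp_all add: w)
    next
      case False
      then have qN: "q \<in> N" "q \<noteq> p" using q by auto
      \<comment> \<open>A trial neighbor of \<open>p\<close> would lie in \<open>Q\<close>; an
        untouched trial point does not see \<open>p\<close>, so its equation persists.\<close>
      have "p \<notin> stencil q"
      proof
        assume "p \<in> stencil q"
        then have "q \<in> neighbors n p"
          using qN D(3) by (auto simp: neighbors_eq_stencil stencil_sym)
        then show False using False Q K' D(4)[OF qN(1)] qN(2) by auto
      qed
      then have "upwind K' v (v q) q = upwind K v (v q) q"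
        using K' by (intro upwind_cong) auto
      moreover have "w q = v q" using False by (simp add: w)
      ultimately show ?thesis using D(7)[OF qN(1)] up_w[OF order_refl] by simp
    qed
  next
    fix q assume "q \<in> \<Gamma>"
    then show "w q = 0" using wK[of q] D(1) D(8)[of q] K' by auto
  next
    fix q assume q: "q \<in> K'"
    show "T q \<le> w q"
    proof (cases "q \<in> K")
      case True
      then show ?thesis using wK[OF q] D(9)[of q] by simp
    next
      case False
      then have "q = p" using q K' by simp
      \<comment> \<open>The trial equation at \<open>p\<close> uses only part of the grid, with
        values dominating \<open>T\<close>; comparison applies.\<close>
      have "T p \<le> v p"
      proof (rule upwind_comparison[OF D(7)[OF p]])
        show "upwind (grid n) T (T p) p \<le> (cost p)\<^sup>2" using upwind_T[OF pO] by simp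
        show "0 < (cost p)\<^sup>2" using cost_pos[OF pg] by (rule zero_less_power)
        show "r \<in> grid n \<and> T r \<le> v r" if "r \<in> K" for r
          using that D(2) D(9)[of r] by auto
      qed
      then show ?thesis using wK[OF q] \<open>q = p\<close> by simp
    qed
  next
    fix q assume "q \<in> K' - \<Gamma>"
    then have q: "q \<in> K'" "q \<notin> \<Gamma>" by auto
    have witness: "\<exists>K0\<subseteq>K'. upwind K0 w (w q) q = (cost q)\<^sup>2 \<and> (\<forall>r\<in>K' - K0. w q - \<delta> \<le> w r)"
      if "K0 \<subseteq> K'" "upwind K0 v (v q) q = (cost q)\<^sup>2" "\<And>r. r \<in> K' - K0 \<Longrightarrow> v q - \<delta> \<le> v r" for K0
    proof (intro exI[of _ K0] conjI ballI)
      show "upwind K0 w (w q) q = (cost q)\<^sup>2"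
        using that(2) up_w[OF that(1)] wK[OF q(1)] by simp
      show "w q - \<delta> \<le> w r" if "r \<in> K' - K0" for r
        using \<open>\<And>r. r \<in> K' - K0 \<Longrightarrow> v q - \<delta> \<le> v r\<close>[OF that] wK[OF q(1)] wK[of r] that by simp
    qed fact
    show "\<exists>K0\<subseteq>K'. upwind K0 w (w q) q = (cost q)\<^sup>2 \<and> (\<forall>r\<in>K' - K0. w q - \<delta> \<le> w r)"
    proof (cases "q \<in> K")
      case True
      then obtain K0 where K0: "K0 \<subseteq> K" "upwind K0 v (v q) q = (cost q)\<^sup>2"
        "\<forall>r\<in>K - K0. v q - \<delta> \<le> v r"
        using D(10)[OF True q(2)] by blast
      show ?thesis
      proof (rule witness[OF _ K0(2)])
        show "K0 \<subseteq> K'" using K0(1) K' by auto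
        show "v q - \<delta> \<le> v r" if "r \<in> K' - K0" for r
          using that K0(3) late[OF True] K' by auto
      qed
    next
      case False
      then have "q = p" using q K' by simp
      show ?thesis
      \<comment> \<open>The witness for \<open>p\<close> is the set known just before its
        acceptance; only \<open>p\<close> itself is added, where the bound is trivial.\<close>
      proof (rule witness[of K])
        show "K \<subseteq> K'" using K' by auto
        show "upwind K v (v q) q = (cost q)\<^sup>2" unfolding \<open>q = p\<close> by (rule D(7)[OF p])
        show "v q - \<delta> \<le> v r" if "r \<in> K' - K" for r
          using that K' \<open>q = p\<close> delta_pos by auto
      qed
    qed
  qed
qed


section \<open>The queue invariant\<close>

text \<open>\<open>s\<close> is the pointer before reduction modulo \<open>nB + 1\<close>. All trial levels lie in a window of
  \<open>nB + 1\<close> consecutive integers, so reduction loses nothing. An outdated entry sits at a level above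
  the current one, hence is reached only after its point has become known.\<close>

definition queue_inv ::
  "int \<Rightarrow> (int \<times> int) set \<Rightarrow> (int \<times> int) set \<Rightarrow> (int \<times> int \<Rightarrow> real)
     \<Rightarrow> (nat \<Rightarrow> (int \<times> int) list) \<Rightarrow> bool" where
  "queue_inv s K N v B \<longleftrightarrow>
     (\<forall>p\<in>N. s \<le> level (v p) \<and> level (v p) \<le> s + int nB \<and> p \<in> set (B (slot nB (level (v p))))) \<and>
     (\<forall>p\<in>K. level (v p) \<le> s) \<and>
     (\<forall>j p. s \<le> j \<longrightarrow> j \<le> s + int nB \<longrightarrow> p \<in> set (B (slot nB j)) \<longrightarrow> p \<notin> K \<longrightarrow>
            p \<in> N \<and> level (v p) \<le> j)"

lemma queue_invD:
  assumes "queue_inv s K N v B"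
  shows "p \<in> N \<Longrightarrow> s \<le> level (v p)" "p \<in> N \<Longrightarrow> level (v p) \<le> s + int nB"
    and "p \<in> N \<Longrightarrow> p \<in> set (B (slot nB (level (v p))))"
    and "p \<in> K \<Longrightarrow> level (v p) \<le> s"
    and "\<lbrakk>p \<in> set (B (slot nB j)); s \<le> j; j \<le> s + int nB; p \<notin> K\<rbrakk> \<Longrightarrow> p \<in> N"
    and "\<lbrakk>p \<in> set (B (slot nB j)); s \<le> j; j \<le> s + int nB; p \<notin> K\<rbrakk> \<Longrightarrow> level (v p) \<le> j"
  using assms unfolding queue_inv_def by blast+

text \<open>No trial point sits at the level given up, since each has an entry in its own bucket.
  The level gained at the top shares that empty bucket, so it holds no entries.\<close>

lemma queue_inv_advance:
  assumes inv: "queue_inv s K N v B" and empty: "B (slot nB s) = []"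
  shows "queue_inv (s + 1) K N v B"
proof -
  note D = queue_invD[OF inv]
  show ?thesis
    unfolding queue_inv_def
  proof (intro conjI ballI allI impI)
    fix p assume p: "p \<in> N"
    have "level (v p) \<noteq> s" using D(3)[OF p] empty by auto
    then show "s + 1 \<le> level (v p)" using D(1)[OF p] by simp
    show "level (v p) \<le> s + 1 + int nB" using D(2)[OF p] by simp
    show "p \<in> set (B (slot nB (level (v p))))" using D(3)[OF p] .
  next
    fix p assume "p \<in> K"
    then show "level (v p) \<le> s + 1" using D(4)[of p] by simp
  next
    fix j p assume j: "s + 1 \<le> j" "j \<le> s + 1 + int nB" "p \<in> set (B (slot nB j))" "p \<notin> K"
    have "j \<noteq> s + int nB + 1" using j(3) empty by (auto simp: slot_wrap)
    then have "s \<le> j" "j \<le> s + int nB" using j by auto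
    then show "p \<in> N" "level (v p) \<le> j" using D(5,6) j(3,4) by auto
  qed
qed

lemma queue_inv_skip:
  assumes inv: "queue_inv s K N v B" and B: "B r = p # ps" and p: "p \<in> K" "p \<notin> N"
  shows "queue_inv s K N v (B(r := ps))"
proof -
  note D = queue_invD[OF inv]
  have sub: "set ((B(r := ps)) i) \<subseteq> set (B i)" for i using B by auto
  have sup: "x \<in> set ((B(r := ps)) i)" if "x \<in> set (B i)" "x \<noteq> p" for x i
    using that B by (cases "i = r") auto
  show ?thesis
    unfolding queue_inv_def
  proof (intro conjI ballI allI impI)
    fix x assume x: "x \<in> N"
    then show "s \<le> level (v x)" "level (v x) \<le> s + int nB" using D(1,2) by auto
    have "x \<noteq> p" using x p by auto
    then show "x \<in> set ((B(r := ps)) (slot nB (level (v x))))" using sup D(3)[OF x] by blast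
  next
    fix x assume "x \<in> K"
    then show "level (v x) \<le> s" using D(4) by simp
  next
    fix j x assume j: "s \<le> j" "j \<le> s + int nB" "x \<in> set ((B(r := ps)) (slot nB j))" "x \<notin> K"
    have "x \<in> set (B (slot nB j))" using sub j(3) by blast
    then show "x \<in> N" "level (v x) \<le> j" using D(5,6) j by auto
  qed
qed

text \<open>The entry clause at \<open>j = s\<close> bounds the level from above, the window from
  below. So an unknown point found at the pointer has the smallest trial level.\<close>

lemma first_entry:
  assumes inv: "queue_inv s K N v B" and B: "B (slot nB s) = p # ps" and p: "p \<notin> K"
  shows "p \<in> N" "level (v p) = s"
proof -
  have "p \<in> set (B (slot nB s))" using B by simp
  then show "p \<in> N" "level (v p) = s"
    using queue_invD[OF inv, of p] p by (force intro: antisym)+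
qed

lemma queue_inv_accept:
  assumes march: "march_inv K N v" and inv: "queue_inv s K N v B"
    and B: "B (slot nB s) = p # ps" and p: "p \<notin> K"
    and K': "K' = insert p K"
    and Q: "Q = neighbors n p - K'"
    and w: "w = (\<lambda>q. if q \<in> Q then trial_value F n K' v q else v q)"
    and qs: "set qs = {q \<in> Q. q \<notin> N \<or> bucket_no nB \<delta> (w q) \<noteq> bucket_no nB \<delta> (v q)}"
  shows "queue_inv s K' (N - {p} \<union> Q) w (fold (enqueue nB \<delta> w) qs (B(slot nB s := ps)))"
    (is "queue_inv s K' ?N' w ?B'")
proof -
  note D = queue_invD[OF inv]
  note first = first_entry[OF inv B p]
  note val = accept_values[OF march first(1), folded K', folded Q]
  have wK: "w q = v q" if "q \<in> K'" for q using that Q by (simp add: w)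
  \<comment> \<open>Trial values only decrease, so an entry left behind stays at or above the
    current level of its point.\<close>
  have w_le: "w q \<le> v q" if "q \<in> N" for q
    using val(3)[OF _ refl that] by (simp add: w)
  have set_B': "set (?B' r) =
      (if r = slot nB s then set ps else set (B r)) \<union> {q \<in> set qs. slot nB (level (w q)) = r}" for r
    by (simp add: set_fold_enqueue bucket_no_eq_slot)
  have old: "q \<in> set (?B' r)" if "q \<in> set (B r)" "q \<noteq> p" for q r
    using that B by (auto simp: set_B')
  have window: "s \<le> level (w q)" "level (w q) \<le> s + int nB" if "q \<in> ?N'" for q
  proof -
    have "s \<le> level (w q) \<and> level (w q) \<le> s + int nB"
    proof (cases "q \<in> Q")
      case True
      then have wq: "w q = trial_value F n K' v q" by (simp add: w)
      have "level (w q) \<le> level (v p + real nB * \<delta>)"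
        using val(2)[OF True wq] by (rule level_mono)
      \<comment> \<open>Either the value exceeds \<open>v p\<close>, whose level is
        \<open>s\<close>, or \<open>q\<close> was trial with the same value and the old bound
        applies.\<close>
      moreover have "s \<le> level (w q)"
        using val(4)[OF True wq] level_mono[of "v p" "w q"] first(2) D(1)[of q] by auto
      ultimately show ?thesis using first(2) by (simp add: level_add_nB)
    next
      case False
      then show ?thesis using that D(1,2)[of q] by (simp add: w)
    qed
    then show "s \<le> level (w q)" "level (w q) \<le> s + int nB" by auto
  qed
  show ?thesis
    unfolding queue_inv_def
  proof (intro conjI ballI allI impI)
    fix q assume q: "q \<in> ?N'"
    show "s \<le> level (w q)" "level (w q) \<le> s + int nB" using window[OF q] by auto
    show "q \<in> set (?B' (slot nB (level (w q))))"
    proof (cases "q \<in> set qs")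
      case True
      then show ?thesis by (simp add: set_B')
    next
      case False
      have "q \<in> N" "q \<noteq> p" using q False qs K' Q by auto
      \<comment> \<open>Without reinsertion the bucket number is unchanged, so the old entry still
        serves.\<close>
      moreover have "slot nB (level (w q)) = slot nB (level (v q))"
      proof (cases "q \<in> Q")
        case True
        then show ?thesis using False \<open>q \<in> N\<close> by (simp add: qs bucket_no_eq_slot)
      qed (simp add: w)
      ultimately show ?thesis using old D(3)[of q] by auto
    qed
  next
    fix q assume "q \<in> K'"
    then show "level (w q) \<le> s" using wK D(4)[of q] first(2) K' by auto
  next
    fix j q assume j: "s \<le> j" "j \<le> s + int nB" "q \<in> set (?B' (slot nB j))" "q \<notin> K'"
    have "q \<in> ?N' \<and> level (w q) \<le> j"
    proof (cases "q \<in> set qs \<and> slot nB (level (w q)) = slot nB j")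
      case True
      then have "q \<in> ?N'" using qs by auto
      then show ?thesis using slot_inj[of nB "level (w q)" j s] window[of q] True j by auto
    next
      case False
      then have "q \<in> set (B (slot nB j))" using j(3) B by (auto simp: set_B' split: if_splits)
      moreover have "q \<notin> K" "q \<noteq> p" using j(4) K' by auto
      ultimately have "q \<in> N" "level (v q) \<le> j" using D(5,6) j(1,2) by auto
      then show ?thesis using level_mono[OF w_le[of q]] \<open>q \<noteq> p\<close> by auto
    qed
    then show "q \<in> ?N'" "level (w q) \<le> j" by auto
  qed
qed

section \<open>The invariants along a run\<close>

definition state_inv :: "fmm_state \<Rightarrow> bool" where
  "state_inv st \<longleftrightarrow> march_inv (known st) (trial st) (val st) \<and>
     (\<exists>s. ptr st = slot nB s \<and> queue_inv s (known st) (trial st) (val st) (buckets st))"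

lemma state_inv_step:
  assumes "mfmm_step F n nB \<delta> st st'" "state_inv st"
  shows "state_inv st'"
  using assms(1)
proof cases
  case advance
  obtain s where s: "ptr st = slot nB s" "queue_inv s (known st) (trial st) (val st) (buckets st)"
    using assms(2) by (auto simp: state_inv_def)
  have "queue_inv (s + 1) (known st) (trial st) (val st) (buckets st)"
    using queue_inv_advance[OF s(2)] advance s(1) by simp
  moreover have "(ptr st + 1) mod (nB + 1) = slot nB (s + 1)" by (simp add: slot_succ s(1))
  ultimately show ?thesis using assms(2) advance(1) unfolding state_inv_def by auto
next
  case (skip p ps)
  obtain s where s: "ptr st = slot nB s" "queue_inv s (known st) (trial st) (val st) (buckets st)"
    and m: "march_inv (known st) (trial st) (val st)"
    using assms(2) by (auto simp: state_inv_def)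
  have "queue_inv s (known st) (trial st) (val st) ((buckets st)(ptr st := ps))"
    using march_invD(4)[OF m, of p] skip by (intro queue_inv_skip[OF s(2)]) auto
  then show ?thesis using s m skip(1) unfolding state_inv_def by auto
next
  case (accept p ps K Q v qs)
  obtain s where s: "ptr st = slot nB s" "queue_inv s (known st) (trial st) (val st) (buckets st)"
    and m: "march_inv (known st) (trial st) (val st)"
    using assms(2) by (auto simp: state_inv_def)
  have B: "buckets st (slot nB s) = p # ps" using accept s(1) by simp
  note first = first_entry[OF s(2) B \<open>p \<notin> known st\<close>]
  have "march_inv K (trial st - {p} \<union> Q) v"
  proof (rule march_inv_accept[OF m first(1)])
    \<comment> \<open>Known levels are at most \<open>s\<close>, the level of \<open>p\<close>;
      passing from levels to values costs one bucket width.\<close>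
    show "val st q - \<delta> \<le> val st p" if "q \<in> known st" for q
      using queue_invD(4)[OF s(2) that] first(2) by (intro level_le_imp) simp
  qed (use accept in simp_all)
  moreover have "queue_inv s K (trial st - {p} \<union> Q) v
      (fold (enqueue nB \<delta> v) qs ((buckets st)(slot nB s := ps)))"
    by (rule queue_inv_accept[OF m s(2) B]) (use accept in simp_all)
  ultimately show ?thesis using s(1) accept(1) unfolding state_inv_def by auto
qed

text \<open>Boundary values are 0, so the initial trial values lie between 0 and
  \<open>real nB * \<delta>\<close>. The unreduced pointer is the level of a smallest one.\<close>

lemma state_inv_init:
  assumes init: "mfmm_init F n \<Omega> \<Gamma> nB \<delta> st"
  shows "state_inv st"
proof -
  define N v where "N = trial st" and "v = val st"
  have N: "N = {p \<in> \<Omega>. neighbors n p \<inter> \<Gamma> \<noteq> {}}" and vG: "\<And>p. p \<in> \<Gamma> \<Longrightarrow> v p = 0"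
    and vN: "\<And>p. p \<in> N \<Longrightarrow> v p = trial_value F n \<Gamma> v p" and K: "known st = \<Gamma>"
    using init by (auto simp: mfmm_init_def N_def v_def)
  obtain ps where ps: "set ps = N" "buckets st = fold (enqueue nB \<delta> v) ps (\<lambda>_. [])"
    using init by (auto simp: mfmm_init_def N_def v_def)
  have ptr: "ptr st \<le> nB"
    and least: "\<And>p. p \<in> N \<Longrightarrow> (\<forall>q\<in>N. v p \<le> v q) \<Longrightarrow> ptr st = bucket_no nB \<delta> (v p)"
    using init by (auto simp: mfmm_init_def N_def v_def)
  have Ng: "N \<subseteq> grid n - \<Gamma>" using N cover disjoint by auto
  have up: "upwind \<Gamma> v (v p) p = (cost p)\<^sup>2"
    and bounds: "0 \<le> v p" "v p \<le> real nB * \<delta>" and st: "stencil p \<inter> \<Gamma> \<noteq> {}" if "p \<in> N" for p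
  proof -
    have pg: "p \<in> grid n" using that Ng by auto
    obtain q where q: "q \<in> stencil p" "q \<in> \<Gamma>"
      using \<open>p \<in> N\<close> unfolding N neighbors_eq_stencil by blast
    then show "stencil p \<inter> \<Gamma> \<noteq> {}" by auto
    show up: "upwind \<Gamma> v (v p) p = (cost p)\<^sup>2"
      using upwind_trial_value[OF q cost_pos[OF pg], of v] vN[OF that] by simp
    show "v p \<le> real nB * \<delta>"
      using upwind_upper_bound[OF up _ q] vG[OF q(2)] cost_pos[OF pg] cost_le[OF pg] by simp
    have "0 < upwind \<Gamma> v (v p) p" unfolding up using cost_pos[OF pg] by (rule zero_less_power)
    then obtain k where "k \<in> \<Gamma>" "v k < v p" by (rule upwind_lower_neighbor)
    then show "0 \<le> v p" using vG[of k] by simp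
  qed
  have "march_inv \<Gamma> N v"
    unfolding march_inv_def
  proof (intro conjI ballI)
    show "\<Gamma> \<subseteq> grid n" using cover by auto
    show "neighbors n p \<subseteq> \<Gamma> \<union> N" if "p \<in> \<Gamma>" for p
    proof
      fix q assume q: "q \<in> neighbors n p"
      then have "p \<in> neighbors n q"
        using that cover by (auto simp: neighbors_eq_stencil stencil_sym)
      moreover have "q \<in> \<Omega> \<union> \<Gamma>" using q cover by (auto simp: neighbors_eq_stencil)
      ultimately show "q \<in> \<Gamma> \<union> N" using that N by auto
    qed
    show "T p \<le> v p" if "p \<in> \<Gamma>" for p using that by (simp add: vG T_boundary)
  qed (use Ng up st vG in auto)
  moreover have "\<exists>s. ptr st = slot nB s \<and> queue_inv s \<Gamma> N v (buckets st)"
  proof -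
    have base: "queue_inv s \<Gamma> N v (buckets st)" if "0 \<le> s" "\<And>p. p \<in> N \<Longrightarrow> s \<le> level (v p)" for s
    proof -
      have upper: "level (v p) \<le> s + int nB" if "p \<in> N" for p
        using level_mono[OF bounds(2)[OF that]] level_add_nB[of 0] \<open>0 \<le> s\<close> by simp
      have B: "set (buckets st r) = {p \<in> N. slot nB (level (v p)) = r}" for r
        by (simp add: ps set_fold_enqueue bucket_no_eq_slot)
      show ?thesis
        unfolding queue_inv_def
      proof (intro conjI ballI allI impI)
        fix p assume p: "p \<in> N"
        show "s \<le> level (v p)" "level (v p) \<le> s + int nB" using that(2)[OF p] upper[OF p] by auto
        show "p \<in> set (buckets st (slot nB (level (v p))))" using p by (simp add: B)
      next
        fix p assume "p \<in> \<Gamma>"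
        then show "level (v p) \<le> s" using vG[of p] \<open>0 \<le> s\<close> by simp
      next
        fix j p assume j: "s \<le> j" "j \<le> s + int nB" and "p \<in> set (buckets st (slot nB j))"
        then have p: "p \<in> N" "slot nB (level (v p)) = slot nB j" by (auto simp: B)
        then show "p \<in> N" "level (v p) \<le> j"
          using slot_inj[OF p(2) that(2)[OF p(1)] upper[OF p(1)] j] by auto
      qed
    qed
    show ?thesis
    proof (cases "N = {}")
      case True
      \<comment> \<open>No trial level constrains the window, and the stored pointer represents
        itself.\<close>
      have "ptr st = slot nB (int (ptr st))" using ptr by (simp add: slot_def)
      then show ?thesis using base[of "int (ptr st)"] True by auto
    next
      case False
      define m where "m = arg_min_on v N"
      have "finite N" using Ng by (rule finite_subset) simp
      then have m: "m \<in> N" "\<And>q. q \<in> N \<Longrightarrow> v m \<le> v q"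
        unfolding m_def using False arg_min_if_finite[of N v] by (auto simp: not_less)
      have "queue_inv (level (v m)) \<Gamma> N v (buckets st)"
        using bounds(1)[OF m(1)] delta_pos level_mono m(2) by (intro base) auto
      moreover have "ptr st = slot nB (level (v m))"
        using least[OF m(1)] m(2) by (simp add: bucket_no_eq_slot)
      ultimately show ?thesis by blast
    qed
  qed
  ultimately show ?thesis by (simp add: state_inv_def K N_def v_def)
qed

section \<open>Termination and the two-sided bound\<close>

lemma terminated_known:
  assumes "state_inv st" "mfmm_terminated nB st"
  shows "trial st = {}" "known st = grid n"
proof -
  obtain s where s: "queue_inv s (known st) (trial st) (val st) (buckets st)"
    and m: "march_inv (known st) (trial st) (val st)"
    using assms(1) by (auto simp: state_inv_def)
  note D = march_invD[OF m]
  \<comment> \<open>Each trial point has an entry in its bucket, so either termination test empties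
    the band.\<close>
  show tr: "trial st = {}"
    using queue_invD(3)[OF s] slot_le assms(2) unfolding mfmm_terminated_def by fastforce
  obtain p where p: "p \<in> \<Gamma>" using nonempty by auto
  have "grid n \<subseteq> known st"
    using p D(1,2) D(5) tr by (intro grid_connected[of p]) auto
  then show "known st = grid n" using D(2) by auto
qed

lemma computed_bounds:
  assumes "mfmm_computes F n \<Omega> \<Gamma> nB \<delta> That" "p \<in> \<Omega>"
  defines "c \<equiv> sqrt 2 * (Fmax / mesh n) * \<delta>"
  shows "T p \<le> That p" "(1 - c) * That p \<le> T p"
proof -
  obtain st0 st where st: "mfmm_init F n \<Omega> \<Gamma> nB \<delta> st0" "(mfmm_step F n nB \<delta>)\<^sup>*\<^sup>* st0 st"
    "mfmm_terminated nB st" "\<forall>p\<in>known st. That p = val st p"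
    using assms(1) by (auto simp: mfmm_computes_def)
  have "state_inv st"
    using st(2) by (induction rule: rtranclp_induct) (auto intro: state_inv_init st(1) state_inv_step)
  note fin = terminated_known[OF this st(3)]
  have m: "march_inv (grid n) {} (val st)"
    using \<open>state_inv st\<close> fin by (simp add: state_inv_def)
  note D = march_invD[OF m]
  have That: "That q = val st q" if "q \<in> grid n" for q using st(4) fin(2) that by auto
  have pg: "p \<in> grid n" using assms(2) cover by auto
  show lower: "T p \<le> That p" using D(9)[OF pg] That[OF pg] by simp
  show "(1 - c) * That p \<le> T p"
  proof (cases "c < 1")
    case True
    have "(1 - c) * val st p \<le> T p"
    proof (rule subsolution_le[OF _ _ pg])
      show "(1 - c) * val st q \<le> 0" if "q \<in> \<Gamma>" for q using D(8)[OF that] by simp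
      fix q assume q: "q \<in> \<Omega>"
      then have qg: "q \<in> grid n" and "q \<notin> \<Gamma>" using cover disjoint by auto
      then obtain K0 where K0: "upwind K0 (val st) (val st q) q = (cost q)\<^sup>2"
        "\<forall>r\<in>grid n - K0. val st q - \<delta> \<le> val st r"
        using D(10)[of q] by auto
      \<comment> \<open>The origin of \<open>Fmax\<close> in the constant: it makes
        \<open>c * cost q\<close> at least \<open>sqrt 2 * \<delta>\<close> at every point, whatever
        the local speed.\<close>
      have "1 \<le> Fmax / speed_at F n q" using speed[OF qg] Fmin by simp
      then have "sqrt 2 * \<delta> * 1 \<le> sqrt 2 * \<delta> * (Fmax / speed_at F n q)"
        using delta_pos by (intro mult_left_mono) auto
      also have "\<dots> = c * cost q" using mesh_pos by (simp add: c_def)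
      finally have "sqrt 2 * \<delta> \<le> c * cost q" by simp
      then show "upwind (grid n) (\<lambda>r. (1 - c) * val st r) ((1 - c) * val st q) q \<le> (cost q)\<^sup>2"
        using K0 cost_pos[OF qg] delta_pos True by (intro upwind_damped) auto
    qed
    then show ?thesis using That[OF pg] by simp
  next
    \<comment> \<open>Damping needs a positive factor; for \<open>1 \<le> c\<close> the left side is
      nonpositive and \<open>T\<close> is nonnegative.\<close>
    case False
    then have "(1 - c) * That p \<le> 0"
      using lower T_nonneg[OF pg] by (intro mult_nonpos_nonneg) auto
    then show ?thesis using T_nonneg[OF pg] by simp
  qed
qed

end

theorem theorem4:
  fixes F :: "real \<times> real \<Rightarrow> real"
    and Fmin Fmax h \<delta> :: real
    and n nB :: nat
    and \<Omega> \<Gamma> :: "(int \<times> int) set"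
    and T That :: "int \<times> int \<Rightarrow> real"
  assumes "continuous_on ({0..1} \<times> {0..1}) F"
    and "0 < Fmin"
    and "\<And>x. x \<in> {0..1} \<times> {0..1} \<Longrightarrow> Fmin \<le> F x \<and> F x \<le> Fmax"
    and "n \<ge> 1"
    and "h = mesh n"
    and "\<Omega> \<union> \<Gamma> = grid n"
    and "\<Omega> \<inter> \<Gamma> = {}"
    and "\<Gamma> \<noteq> {}"
    and "nB \<ge> 1"
    and "\<delta> = h / (Fmin * real nB)"
    and "discrete_eikonal_solution F n \<Omega> \<Gamma> T"
    and "mfmm_computes F n \<Omega> \<Gamma> nB \<delta> That"
  shows "(\<forall>p\<in>\<Omega>. 0 \<le> (That p - T p) / \<bar>That p\<bar> \<and>
                 (That p - T p) / \<bar>That p\<bar> \<le> sqrt 2 * (Fmax / h) * \<delta>) \<and>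
         sqrt 2 * (Fmax / h) * \<delta> = sqrt 2 * (Fmax / Fmin) * (1 / real nB)"
proof -
  have speed: "Fmin \<le> speed_at F n p \<and> speed_at F n p \<le> Fmax" if "p \<in> grid n" for p
  proof -
    obtain i j where "p = (i, j)" by (cases p)
    then show ?thesis
      using that \<open>n \<ge> 1\<close>
      by (auto simp: grid_def mesh_def divide_le_eq intro!: assms(3)[THEN conjunct1] assms(3)[THEN conjunct2])
  qed
  interpret fast_marching F Fmin Fmax \<delta> n nB \<Omega> \<Gamma> T
    by unfold_locales (fact | simp add: assms(5,10))+
  have "0 \<le> (That p - T p) / \<bar>That p\<bar> \<and> (That p - T p) / \<bar>That p\<bar> \<le> sqrt 2 * (Fmax / h) * \<delta>"
    if p: "p \<in> \<Omega>" for p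
  proof -
    note bounds = computed_bounds[OF assms(12) p, folded assms(5)]
    \<comment> \<open>Positivity removes the absolute value and allows the quotient to be
      cleared.\<close>
    have "0 < That p" using T_pos[OF p] bounds(1) by simp
    then show ?thesis using bounds by (simp add: field_simps)
  qed
  moreover have "sqrt 2 * (Fmax / h) * \<delta> = sqrt 2 * (Fmax / Fmin) * (1 / real nB)"
    using mesh_pos assms(5,10) by simp
  ultimately show ?thesis by blast
qed

end
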